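(* Let $X$ be a commutative ring with an equivalence relation $\sim$ such that the canonical surjection $X\to X/\!\sim$, $x\mapsto [x]_m$, is a surjective morphism of rings. Let $k\ge 2$, let $f:X^k\to X$ be a linear map, $f(x_1,\ldots,x_k)=\sum_{j=1}^k f_j x_j$ with $f_1,\ldots,f_k\in X$, and let $(a_n)_{n\ge 1}$ be the sequence in $X$ with given initial values $a_1,a_2,\ldots,a_k$ and $a_{i+k}=f(a_i,\ldots,a_{i+k-1})$ for all $i\ge 1$. If $a$ is a periodic sequence modulo $m$ with period $\ell(m)$, then $$[a_k]_m=[f_1]_m[a_{\ell(m)}]_m+\sum_{i=2}^k[f_i]_m[a_{i-1}]_m.$$
   Context: $[x]_m$ denotes the class of $x\in X$ in $X/\!\sim$; in the basic case $X=\mathbb{Z}$, $m$ is a positive integer, $\sim$ is congruence modulo $m$ and $[x]_m$ is the residue class of $x$ in $\mathbb{Z}/m\mathbb{Z}$. A sequence $(a_n)_{n\ge1}$ is periodic modulo $m$ with period $\ell(m)$ (a positive integer) if $[a_n]_m=[a_{n+\ell(m)}]_m$ for all $n\ge 1$. *)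

theory Defs
  imports "HOL-Algebra.Algebra"
begin

text \<open>
  \<open>Q\<close> is the quotient set \<open>R/\<sim>\<close> with a ring structure for which the canonical map
  \<open>x \<mapsto> [x]\<close>, where \<open>[x] = r `` {x}\<close>, is a morphism of rings. Surjectivity of this map is
  the equation for the carrier, since \<open>carrier R // r\<close> is by definition its image.
\<close>

definition quotient_ring_by ::
  "('a, 'm) ring_scheme \<Rightarrow> 'a rel \<Rightarrow> ('a set, 'n) ring_scheme \<Rightarrow> bool" where
  "quotient_ring_by R r Q \<longleftrightarrow>
     equiv (carrier R) r \<and> ring Q \<and> carrier Q = carrier R // r \<and>
     (\<lambda>x. r `` {x}) \<in> ring_hom R Q"

text \<open>Sequences are indexed from 1; the value at 0 is irrelevant. The period need not be minimal.\<close>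

definition periodic_mod :: "'a rel \<Rightarrow> (nat \<Rightarrow> 'a) \<Rightarrow> nat \<Rightarrow> bool" where
  "periodic_mod r a l \<longleftrightarrow> l > 0 \<and> (\<forall>n\<ge>1. r `` {a n} = r `` {a (n + l)})"

end

theory Submission
  imports Defs
begin

text \<open>
  Shift the recurrence by one full period: for \<open>i = l\<close> it expresses \<open>a (k + l)\<close> through
  \<open>a l, a (l + 1), \<dots>, a (l + k - 1)\<close>. Modulo \<open>r\<close>, periodicity replaces \<open>a (k + l)\<close> by \<open>a k\<close> and
  each \<open>a (l + i - 1)\<close> with \<open>i \<ge> 2\<close> by \<open>a (i - 1)\<close>. Only \<open>a l\<close> has to stay, since its replacement
  would be the term of index 0, which is not part of the sequence. The quotient map being a ring
  morphism, it carries the linear relation in \<open>R\<close> to the one between residue classes.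
\<close>

lemma (in ring_hom_ring) hom_linear_combination:
  assumes "c \<in> A \<rightarrow> carrier R" and "x \<in> A \<rightarrow> carrier R"
  shows "h (\<Oplus>\<^bsub>R\<^esub>j\<in>A. c j \<otimes>\<^bsub>R\<^esub> x j) = (\<Oplus>\<^bsub>S\<^esub>j\<in>A. h (c j) \<otimes>\<^bsub>S\<^esub> h (x j))"
proof -
  have "h (\<Oplus>\<^bsub>R\<^esub>j\<in>A. c j \<otimes>\<^bsub>R\<^esub> x j) = (\<Oplus>\<^bsub>S\<^esub>j\<in>A. (h \<circ> (\<lambda>j. c j \<otimes>\<^bsub>R\<^esub> x j)) j)"
    using assms by (subst hom_finsum) (auto simp: Pi_iff)
  also have "\<dots> = (\<Oplus>\<^bsub>S\<^esub>j\<in>A. h (c j) \<otimes>\<^bsub>S\<^esub> h (x j))"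
    using assms by (intro S.finsum_cong') (auto simp: Pi_iff)
  finally show ?thesis .
qed

theorem theorem2p8:
  fixes R :: "('a, 'm) ring_scheme"
    and r :: "'a rel"
    and Q :: "('a set, 'n) ring_scheme"
    and k l :: nat
    and f :: "(nat \<Rightarrow> 'a) \<Rightarrow> 'a"
    and c a :: "nat \<Rightarrow> 'a"
  assumes "cring R"
    and "quotient_ring_by R r Q"
    and "k \<ge> 2"
    and "\<And>j. j \<in> {1..k} \<Longrightarrow> c j \<in> carrier R"
    and "\<And>x. x \<in> {1..k} \<rightarrow>\<^sub>E carrier R \<Longrightarrow>
           f x = (\<Oplus>\<^bsub>R\<^esub>j\<in>{1..k}. c j \<otimes>\<^bsub>R\<^esub> x j)"
    and "\<And>n. n \<ge> 1 \<Longrightarrow> a n \<in> carrier R"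
    and "\<And>i. i \<ge> 1 \<Longrightarrow> a (i + k) = f (\<lambda>j\<in>{1..k}. a (i + j - 1))"
    and "periodic_mod r a l"
  shows "r `` {a k} =
           (r `` {c 1} \<otimes>\<^bsub>Q\<^esub> r `` {a l}) \<oplus>\<^bsub>Q\<^esub>
           (\<Oplus>\<^bsub>Q\<^esub>i\<in>{2..k}. r `` {c i} \<otimes>\<^bsub>Q\<^esub> r `` {a (i - 1)})"
proof -
  interpret R: cring R by fact
  define h where "h = (\<lambda>x. r `` {x})"
  from assms(2) have ring_Q: "ring Q" and hom: "h \<in> ring_hom R Q"
    by (simp_all add: quotient_ring_by_def h_def)
  interpret h: ring_hom_ring R Q h
    using R.ring_axioms ring_Q hom by (rule ring_hom_ringI2)
  from assms(8) have l: "l \<ge> 1" and per: "\<And>n. n \<ge> 1 \<Longrightarrow> h (a n) = h (a (n + l))"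
    unfolding periodic_mod_def h_def by (linarith, blast)
  have c: "c \<in> {1..k} \<rightarrow> carrier R"
    using assms(4) by blast
  have a_shift: "(\<lambda>j. a (l + j - 1)) \<in> {1..k} \<rightarrow> carrier R"
    using l by (intro Pi_I assms(6)) auto
  have "a (l + k) = (\<Oplus>\<^bsub>R\<^esub>j\<in>{1..k}. c j \<otimes>\<^bsub>R\<^esub> (\<lambda>j\<in>{1..k}. a (l + j - 1)) j)"
    unfolding assms(7)[OF l] by (rule assms(5)) (use a_shift in \<open>simp only: restrict_PiE_iff Pi_iff\<close>)
  also have "\<dots> = (\<Oplus>\<^bsub>R\<^esub>j\<in>{1..k}. c j \<otimes>\<^bsub>R\<^esub> a (l + j - 1))"
    using c a_shift by (intro R.finsum_cong') (simp_all add: Pi_iff)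
  finally have rec: "a (l + k) = (\<Oplus>\<^bsub>R\<^esub>j\<in>{1..k}. c j \<otimes>\<^bsub>R\<^esub> a (l + j - 1))" .
  have terms: "(\<lambda>j. h (c j) \<otimes>\<^bsub>Q\<^esub> h (a (l + j - 1))) \<in> {1..k} \<rightarrow> carrier Q"
    using c a_shift by (simp add: Pi_iff)
  have split: "{1..k} = insert 1 {2..k}"
    using assms(3) by auto
  have "h (a k) = h (a (l + k))"
    using per[of k] assms(3) by (simp add: add.commute)
  also have "\<dots> = (\<Oplus>\<^bsub>Q\<^esub>j\<in>{1..k}. h (c j) \<otimes>\<^bsub>Q\<^esub> h (a (l + j - 1)))"
    unfolding rec using c a_shift by (rule h.hom_linear_combination)
  also have "\<dots> = (h (c 1) \<otimes>\<^bsub>Q\<^esub> h (a l)) \<oplus>\<^bsub>Q\<^esub>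
      (\<Oplus>\<^bsub>Q\<^esub>j\<in>{2..k}. h (c j) \<otimes>\<^bsub>Q\<^esub> h (a (l + j - 1)))"
    using terms unfolding split by (subst h.S.finsum_insert) (simp_all add: Pi_iff)
  also have "(\<Oplus>\<^bsub>Q\<^esub>j\<in>{2..k}. h (c j) \<otimes>\<^bsub>Q\<^esub> h (a (l + j - 1))) =
      (\<Oplus>\<^bsub>Q\<^esub>i\<in>{2..k}. h (c i) \<otimes>\<^bsub>Q\<^esub> h (a (i - 1)))"
  proof (rule h.S.finsum_cong')
    fix i assume i: "i \<in> {2..k}"
    then have "i - 1 \<ge> 1" and "l + i - 1 = i - 1 + l"
      by auto
    then have "h (a (l + i - 1)) = h (a (i - 1))"
      using per[of "i - 1"] by metis
    then show "h (c i) \<otimes>\<^bsub>Q\<^esub> h (a (l + i - 1)) = h (c i) \<otimes>\<^bsub>Q\<^esub> h (a (i - 1))"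
      by simp
  qed (use assms(4,6) in \<open>auto simp: Pi_iff\<close>)
  finally show ?thesis
    unfolding h_def .
qed

end
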